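(* Let $P$ be any non-degenerate probability distribution on $[0,1]$ with mean $m$, and let $X_1,X_2,\dots$ be i.i.d. with law $P$. For a probability measure $\pi$ on $[-1,1]$ let $$W_n^\pi=\int\Bigl\{\prod_{k=1}^n\bigl(1+\lambda(X_k-m)\bigr)\Bigr\}\,\pi(\mathrm d\lambda).$$ Then $W_n^\pi\to0$ almost surely as $n\to\infty$ in each of the following two cases: (i) (universal portfolio) $\pi$ is a Beta distribution rescaled to $[-1,1]$; (ii) (Robbins' iterated logarithm mixture) $\pi$ has density $$f_\pi(\lambda)=\frac{\mathbf 1_{\{|\lambda|\le1\}}\,\log\log C}{2|\lambda|\,\log(C/|\lambda|)\,\bigl(\log\log(C/|\lambda|)\bigr)^2},\qquad C=6.6\,e.$$
   Context: "Non-degenerate" means that $P$ is not a point mass (so $0<m<1$, and $[-1,1]\subseteq[-\frac1{1-m},\frac1m]$). A Beta distribution rescaled to $[-1,1]$ is the law of $2B-1$ where $B$ has a Beta$(a,b)$ distribution with $a,b>0$. *)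

theory Defs
  imports "HOL-Probability.Probability"
begin

definition beta_density :: "real \<Rightarrow> real \<Rightarrow> real \<Rightarrow> real" where
  "beta_density a b x = indicator {0<..<1} x * (x powr (a - 1) * (1 - x) powr (b - 1) / Beta a b)"

definition beta_distribution :: "real \<Rightarrow> real \<Rightarrow> real measure" where
  "beta_distribution a b = density lborel (\<lambda>x. ennreal (beta_density a b x))"

definition rescaled_beta :: "real \<Rightarrow> real \<Rightarrow> real measure" where
  "rescaled_beta a b = distr (beta_distribution a b) borel (\<lambda>x. 2 * x - 1)"

definition robbins_const :: real where
  "robbins_const = 66 / 10 * exp 1"

text \<open>Since division by zero yields zero, the density takes the value 0 at the origin,
  a null set. On the rest of its support all the logarithms are positive, because
  \<open>ln (ln robbins_const) > 0\<close>.\<close>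

definition robbins_density :: "real \<Rightarrow> real" where
  "robbins_density x =
     indicator {x. \<bar>x\<bar> \<le> 1} x * ln (ln robbins_const) /
     (2 * \<bar>x\<bar> * ln (robbins_const / \<bar>x\<bar>) * (ln (ln (robbins_const / \<bar>x\<bar>)))\<^sup>2)"

definition robbins_mixture :: "real measure" where
  "robbins_mixture = density lborel (\<lambda>x. ennreal (robbins_density x))"

text \<open>The mixing measures are Borel measures on the whole real line that are concentrated
  on \<open>{-1..1}\<close>. The observations are \<open>X 1, X 2, \<dots>\<close>; the value \<open>X 0\<close> is never used.\<close>

definition mixture_wealth ::
  "real measure \<Rightarrow> real \<Rightarrow> (nat \<Rightarrow> 'a \<Rightarrow> real) \<Rightarrow> nat \<Rightarrow> 'a \<Rightarrow> real" where
  "mixture_wealth \<pi> m X n \<omega> = (\<integral>l. (\<Prod>k = 1..n. 1 + l * (X k \<omega> - m)) \<partial>\<pi>)"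

end

theory Submission
  imports Defs
begin

text \<open>Only two properties of the mixing measures matter: they are finite measures on
  \<open>{-1..1}\<close> and have no atom at \<open>0\<close>. Split the mixture at \<open>\<bar>\<lambda>\<bar> = \<delta>\<close>. The part
  \<open>\<bar>\<lambda>\<bar> \<ge> \<delta>\<close> tends to \<open>0\<close> almost surely: since \<open>1 + x \<le> exp (x - x\<^sup>2 / 6)\<close> on
  \<open>{-1..1}\<close>, its integrand is at most \<open>exp (\<bar>S n\<bar> - \<delta>\<^sup>2 V n / 6)\<close>, where \<open>S n\<close> and
  \<open>V n\<close> are the sums of the centred observations and of their squares, and the strong law gives
  \<open>S n / n \<longlonglongrightarrow> 0\<close> and \<open>V n / n \<longlonglongrightarrow> v > 0\<close>. The part \<open>\<bar>\<lambda>\<bar> < \<delta>\<close> is a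
  nonnegative martingale started at the mass of \<open>{-\<delta><..<\<delta>}\<close>, which is small with \<open>\<delta>\<close>;
  Ville's maximal inequality therefore bounds it uniformly in \<open>n\<close>.\<close>

section \<open>Ville's maximal inequality for nonnegative processes\<close>

text \<open>Stop \<open>U\<close> when it first reaches \<open>c\<close>. The hypothesis
  \<open>step\<close> is the martingale property in the form that this needs: increments average to
  zero over the event that \<open>c\<close> has not been reached yet. No filtration or conditional
  expectation appears.\<close>

lemma (in prob_space) nonneg_maximal_inequality:
  fixes U :: "nat \<Rightarrow> 'a \<Rightarrow> real"
  assumes int: "\<And>n. integrable M (U n)" and nonneg: "\<And>n \<omega>. 0 \<le> U n \<omega>" and c: "c > 0"
    and step: "\<And>n. expectation (\<lambda>\<omega>. (U (Suc n) \<omega> - U n \<omega>) * (if \<forall>k\<le>n. U k \<omega> < c then 1 else 0)) = 0"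
  shows "prob {\<omega> \<in> space M. \<exists>n. c \<le> U n \<omega>} \<le> expectation (U 0) / c"
proof -
  have [measurable]: "U n \<in> borel_measurable M" for n
    using int by blast
  define b where "b n \<omega> = (if \<forall>k\<le>n. U k \<omega> < c then 1 else 0 :: real)" for n \<omega>
  have [measurable]: "b n \<in> borel_measurable M" for n
    unfolding b_def by measurable
  have int_b: "integrable M (b n)" for n
    by (rule integrable_const_bound[of _ 1]) (auto simp: b_def)
  have int_Ub: "integrable M (\<lambda>\<omega>. U m \<omega> * b n \<omega>)" for m n
    by (rule Bochner_Integration.integrable_bound[OF int[of m]]) (auto simp: b_def)
  \<comment> \<open>\<open>V\<close> follows \<open>U\<close> while the path stays below
    \<open>c\<close> and is frozen at exactly \<open>c\<close> from the first crossing on, so any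
    overshoot is discarded.\<close>
  define V where "V n \<omega> = U n \<omega> * b n \<omega> + c * (1 - b n \<omega>)" for n \<omega>
  have int_V: "integrable M (V n)" for n
    unfolding V_def using int_Ub int_b by (intro Bochner_Integration.integrable_add integrable_mult_right Bochner_Integration.integrable_diff) auto
  have V_le: "expectation (V n) \<le> expectation (U 0)" for n
  proof (induction n)
    case 0
    show ?case
      by (rule integral_mono[OF int_V int]) (auto simp: V_def b_def)
  next
    case (Suc n)
    have int_d: "integrable M (\<lambda>\<omega>. (U (Suc n) \<omega> - U n \<omega>) * b n \<omega>)"
      using int_Ub by (simp add: left_diff_distrib)
    \<comment> \<open>Pointwise, the two sides differ only at the moment of crossing, where the
      right side is \<open>U (Suc n)\<close> and the left side is the smaller value
      \<open>c\<close>.\<close>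
    have "expectation (V (Suc n)) \<le> expectation (\<lambda>\<omega>. (U (Suc n) \<omega> - U n \<omega>) * b n \<omega> + V n \<omega>)"
    proof (rule integral_mono)
      show "integrable M (\<lambda>\<omega>. (U (Suc n) \<omega> - U n \<omega>) * b n \<omega> + V n \<omega>)"
        using int_d int_V by (rule Bochner_Integration.integrable_add)
    qed (use int_V in \<open>auto simp: V_def b_def le_Suc_eq\<close>)
    also have "\<dots> = expectation (V n)"
      using int_d int_V step[of n] unfolding b_def by simp
    finally show ?case using Suc.IH by simp
  qed
  define E where "E n = {\<omega> \<in> space M. \<exists>k\<le>n. c \<le> U k \<omega>}" for n
  have [measurable]: "E n \<in> events" for n
    unfolding E_def by measurable
  have "prob (E n) \<le> expectation (U 0) / c" for n
  proof -
    have "c * prob (E n) = expectation (\<lambda>\<omega>. c * indicator (E n) \<omega>)"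
      by simp
    \<comment> \<open>On \<open>E n\<close> the process is already frozen at \<open>c\<close>; off
      \<open>E n\<close> it equals \<open>U n\<close>, which is nonnegative.\<close>
    also have "\<dots> \<le> expectation (V n)"
    proof (rule integral_mono[OF _ int_V])
      show "integrable M (\<lambda>\<omega>. c * indicator (E n) \<omega>)"
        by (simp add: less_top[symmetric])
    qed (use c in \<open>auto simp: V_def b_def E_def nonneg not_le indicator_def\<close>)
    finally show ?thesis
      using V_le[of n] c by (simp add: field_simps)
  qed
  moreover have "(\<lambda>n. prob (E n)) \<longlonglongrightarrow> prob (\<Union>n. E n)"
    by (rule finite_Lim_measure_incseq) (auto simp: E_def incseq_def intro: order_trans)
  ultimately have "prob (\<Union>n. E n) \<le> expectation (U 0) / c"
    by (intro LIMSEQ_le_const2) auto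
  also have "(\<Union>n. E n) = {\<omega> \<in> space M. \<exists>n. c \<le> U n \<omega>}"
    by (auto simp: E_def)
  finally show ?thesis .
qed

section \<open>Bounds, integrability and measurability of mixtures of products\<close>

lemma prod_one_plus_bounds:
  fixes l :: real
  assumes "\<bar>l\<bar> \<le> 1" "\<And>k. \<bar>y k\<bar> \<le> 1"
  shows "0 \<le> (\<Prod>k=1..n. 1 + l * y k)" "(\<Prod>k=1..n. 1 + l * y k) \<le> 2 ^ n"
proof -
  have "\<bar>l * y k\<bar> \<le> 1" for k
    using assms by (simp add: abs_mult mult_le_one)
  then have *: "0 \<le> 1 + l * y k \<and> 1 + l * y k \<le> 2" for k
    by (smt (verit))
  show "0 \<le> (\<Prod>k=1..n. 1 + l * y k)"
    using * by (intro prod_nonneg) auto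
  have "(\<Prod>k=1..n. 1 + l * y k) \<le> (\<Prod>k=1..n. 2)"
    using * by (intro prod_mono) auto
  then show "(\<Prod>k=1..n. 1 + l * y k) \<le> 2 ^ n"
    by simp
qed

text \<open>The weight \<open>g\<close> has three uses: 1 for the mixture itself, \<open>l\<close>
  for the coefficient of its next increment, and an indicator for the split at
  \<open>\<delta>\<close>.\<close>

lemma integrable_prod_one_plus:
  fixes \<nu> :: "real measure"
  assumes "finite_measure \<nu>" and sets: "sets \<nu> = sets borel" and "AE l in \<nu>. \<bar>l\<bar> \<le> 1"
    and y: "\<And>k. \<bar>y k\<bar> \<le> 1"
    and g: "g \<in> borel_measurable borel" "\<And>l. \<bar>l\<bar> \<le> 1 \<Longrightarrow> \<bar>g l\<bar> \<le> 1"
  shows "integrable \<nu> (\<lambda>l. g l * (\<Prod>k=1..n. 1 + l * y k))"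
    and "\<bar>\<integral>l. g l * (\<Prod>k=1..n. 1 + l * y k) \<partial>\<nu>\<bar> \<le> 2 ^ n * measure \<nu> (space \<nu>)"
proof -
  interpret finite_measure \<nu> by fact
  note [measurable_cong] = sets
  note [measurable] = g(1)
  have bnd: "AE l in \<nu>. norm (g l * (\<Prod>k=1..n. 1 + l * y k)) \<le> 2 ^ n"
    using assms(3)
  proof eventually_elim
    case (elim l)
    then show ?case
      using prod_one_plus_bounds[of l y n] y g(2)[of l]
      by (simp add: abs_mult) (metis abs_ge_zero abs_of_nonneg mult_left_le_one_le order_trans)
  qed
  show int: "integrable \<nu> (\<lambda>l. g l * (\<Prod>k=1..n. 1 + l * y k))"
    by (rule integrable_const_bound[OF bnd]) measurable
  have "\<bar>\<integral>l. g l * (\<Prod>k=1..n. 1 + l * y k) \<partial>\<nu>\<bar> \<le> (\<integral>l. \<bar>g l * (\<Prod>k=1..n. 1 + l * y k)\<bar> \<partial>\<nu>)"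
    by (rule integral_abs_bound)
  also have "\<dots> \<le> (\<integral>l. 2 ^ n \<partial>\<nu>)"
    using bnd int by (intro integral_mono_AE) auto
  finally show "\<bar>\<integral>l. g l * (\<Prod>k=1..n. 1 + l * y k) \<partial>\<nu>\<bar> \<le> 2 ^ n * measure \<nu> (space \<nu>)"
    by (simp add: mult.commute)
qed

text \<open>Allowing \<open>N\<close> beyond \<open>n\<close> makes the mixtures at all times up to
  \<open>N\<close> functions on one product space, so a condition on the whole past is measurable
  there.\<close>

lemma measurable_mixture_prod:
  fixes \<nu> :: "real measure" and n N :: nat
  assumes "finite_measure \<nu>" and sets: "sets \<nu> = sets borel"
    and g [measurable]: "g \<in> borel_measurable borel" and n: "n \<le> N"
  shows "(\<lambda>x. \<integral>l. g l * (\<Prod>k=1..n. 1 + l * x k) \<partial>\<nu>) \<in> borel_measurable (Pi\<^sub>M {1..N} (\<lambda>_. borel))"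
proof -
  interpret finite_measure \<nu> by fact
  note [measurable_cong] = sets
  have *: "(\<lambda>x. fst x k) \<in> borel_measurable (Pi\<^sub>M {1..N} (\<lambda>_. borel) \<Otimes>\<^sub>M \<nu>)"
    if "k \<in> {1..n}" for k
    using that n by (intro measurable_compose[OF measurable_fst measurable_component_singleton]) auto
  show ?thesis
    by (intro borel_measurable_lebesgue_integral, unfold case_prod_beta)
      (intro borel_measurable_times borel_measurable_prod borel_measurable_add *, measurable)
qed

section \<open>The mixture as a martingale\<close>

text \<open>The block of the first \<open>n\<close> variables is independent of the next one, so the
  expectation factors and the centred factor makes it vanish. This plays the part of conditioning on
  the past.\<close>

lemma (in prob_space) expectation_past_times_next:
  fixes Y :: "nat \<Rightarrow> 'a \<Rightarrow> real"
  assumes indep: "indep_vars (\<lambda>_. borel) Y {1..}"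
    and H: "H \<in> borel_measurable (Pi\<^sub>M {1..n} (\<lambda>_. borel))"
    and int: "integrable M (\<lambda>\<omega>. H (\<lambda>k\<in>{1..n}. Y k \<omega>))" "integrable M (Y (Suc n))"
    and "expectation (Y (Suc n)) = 0"
  shows "expectation (\<lambda>\<omega>. H (\<lambda>k\<in>{1..n}. Y k \<omega>) * Y (Suc n) \<omega>) = (0::real)"
proof -
  have "indep_vars (\<lambda>_. borel) Y (insert (Suc n) {1..n})"
    by (rule indep_vars_subset[OF indep]) auto
  then have "indep_var (Pi\<^sub>M {1..n} (\<lambda>_. borel)) (\<lambda>\<omega>. \<lambda>k\<in>{1..n}. Y k \<omega>)
      (Pi\<^sub>M {Suc n} (\<lambda>_. borel)) (\<lambda>\<omega>. \<lambda>k\<in>{Suc n}. Y k \<omega>)"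
    by (rule indep_var_restrict) auto
  from indep_var_compose[OF this H, of "\<lambda>x. x (Suc n)" borel]
  have "indep_var borel (\<lambda>\<omega>. H (\<lambda>k\<in>{1..n}. Y k \<omega>)) borel (Y (Suc n))"
    by (simp add: comp_def)
  from indep_var_lebesgue_integral[OF this int] show ?thesis
    using assms(5) by simp
qed

text \<open>Each increment of the mixture is a function of the past times the next centred variable,
  so the maximal inequality applies. \<open>\<nu>\<close> may have any finite mass because it will
  be a restriction of the mixing measure to a small interval.\<close>

lemma (in prob_space) mixture_maximal_inequality:
  fixes Y :: "nat \<Rightarrow> 'a \<Rightarrow> real" and \<nu> :: "real measure"
  assumes indep: "indep_vars (\<lambda>_. borel) Y {1..}"
    and bnd: "\<And>k \<omega>. \<bar>Y k \<omega>\<bar> \<le> 1" and mean: "\<And>k. k \<ge> 1 \<Longrightarrow> expectation (Y k) = 0"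
    and fin: "finite_measure \<nu>" and sets: "sets \<nu> = sets borel" and AE1: "AE l in \<nu>. \<bar>l\<bar> \<le> 1"
    and c: "c > 0"
  shows "prob {\<omega> \<in> space M. \<exists>n. c \<le> (\<integral>l. (\<Prod>k=1..n. 1 + l * Y k \<omega>) \<partial>\<nu>)} \<le> measure \<nu> (space \<nu>) / c"
    and "(\<lambda>\<omega>. \<integral>l. (\<Prod>k=1..n. 1 + l * Y k \<omega>) \<partial>\<nu>) \<in> borel_measurable M"
proof -
  interpret \<nu>: finite_measure \<nu> by fact
  note [measurable_cong] = sets
  have Y[measurable]: "Y k \<in> borel_measurable M" if "k \<ge> 1" for k
    using indep that by (auto simp: indep_vars_def)
  have restr[measurable]: "(\<lambda>\<omega>. \<lambda>k\<in>{1..n}. Y k \<omega>) \<in> measurable M (Pi\<^sub>M {1..n} (\<lambda>_. borel))" for n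
    by (intro measurable_restrict) auto
  \<comment> \<open>\<open>u\<close> and \<open>d\<close> take a sequence of values instead of a
    sample point, so that they can be composed with the random vector of the past.\<close>
  define u where "u n y = (\<integral>l. (\<Prod>k=1..n. 1 + l * y k) \<partial>\<nu>)" for n :: nat and y :: "nat \<Rightarrow> real"
  define d where "d n y = (\<integral>l. l * (\<Prod>k=1..n. 1 + l * y k) \<partial>\<nu>)" for n :: nat and y :: "nat \<Rightarrow> real"
  have u_meas[measurable]: "u n \<in> borel_measurable (Pi\<^sub>M {1..N} (\<lambda>_. borel))" if "n \<le> N" for n N
    using measurable_mixture_prod[OF fin sets, of "\<lambda>_. 1"] that by (simp add: u_def[abs_def])
  have d_meas[measurable]: "d n \<in> borel_measurable (Pi\<^sub>M {1..n} (\<lambda>_. borel))" for n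
    using measurable_mixture_prod[OF fin sets, of "\<lambda>l. l" n n] by (simp add: d_def[abs_def])
  \<comment> \<open>Restriction makes the sequence \<open>undefined\<close> outside
    \<open>{1..N}\<close>, but \<open>u n\<close> reads only the coordinates 1 to
    \<open>n\<close>.\<close>
  have u_restr: "u n (\<lambda>k\<in>{1..N}. y k) = u n y" if "n \<le> N" for n N y
    unfolding u_def using that by (intro Bochner_Integration.integral_cong prod.cong) auto
  have d_restr: "d n (\<lambda>k\<in>{1..n}. y k) = d n y" for n y
    unfolding d_def by (intro Bochner_Integration.integral_cong refl arg_cong2[where f = "(*)"] prod.cong) auto
  define U where "U n \<omega> = u n (\<lambda>k. Y k \<omega>)" for n \<omega>
  have U_meas[measurable]: "U n \<in> borel_measurable M" for n
    using measurable_compose[OF restr u_meas, OF order_refl] by (simp only: u_restr order_refl U_def[abs_def])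
  have int_prod: "integrable \<nu> (\<lambda>l. \<Prod>k=1..n. 1 + l * Y k \<omega>)"
    and U_bound: "\<bar>U n \<omega>\<bar> \<le> 2 ^ n * measure \<nu> (space \<nu>)" for n \<omega>
    using integrable_prod_one_plus[OF fin sets AE1, of "\<lambda>k. Y k \<omega>" "\<lambda>_. 1" n] bnd
    by (simp_all add: U_def u_def)
  have int_l_prod: "integrable \<nu> (\<lambda>l. l * (\<Prod>k=1..n. 1 + l * Y k \<omega>))"
    and D_bound: "\<bar>d n (\<lambda>k. Y k \<omega>)\<bar> \<le> 2 ^ n * measure \<nu> (space \<nu>)" for n \<omega>
    using integrable_prod_one_plus[OF fin sets AE1, of "\<lambda>k. Y k \<omega>" "\<lambda>l. l" n] bnd
    by (simp_all add: d_def)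
  have U_nonneg: "0 \<le> U n \<omega>" for n \<omega>
    unfolding U_def u_def
    by (intro integral_nonneg_AE eventually_mono[OF AE1] prod_one_plus_bounds(1) bnd)
  \<comment> \<open>Expanding the newest factor of the product leaves the old mixture plus the
    \<open>l\<close>-weighted mixture \<open>d n\<close> times the new observation.\<close>
  have U_Suc: "U (Suc n) \<omega> - U n \<omega> = d n (\<lambda>k. Y k \<omega>) * Y (Suc n) \<omega>" for n \<omega>
  proof -
    have "U (Suc n) \<omega> = (\<integral>l. (\<Prod>k=1..n. 1 + l * Y k \<omega>)
        + (l * (\<Prod>k=1..n. 1 + l * Y k \<omega>)) * Y (Suc n) \<omega> \<partial>\<nu>)"
      unfolding U_def u_def by (intro Bochner_Integration.integral_cong) (auto simp: algebra_simps)
    also have "\<dots> = U n \<omega> + d n (\<lambda>k. Y k \<omega>) * Y (Suc n) \<omega>"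
      unfolding U_def u_def d_def using int_prod int_l_prod by simp
    finally show ?thesis by simp
  qed
  have int_U: "integrable M (U n)" for n
    by (rule integrable_const_bound[of _ "2 ^ n * measure \<nu> (space \<nu>)"]) (use U_bound in auto)
  have step: "expectation (\<lambda>\<omega>. (U (Suc n) \<omega> - U n \<omega>) * (if \<forall>k\<le>n. U k \<omega> < c then 1 else 0)) = 0" for n
  proof -
    \<comment> \<open>The increment coefficient times the indicator of no crossing so far, both read
      off from the first \<open>n\<close> values.\<close>
    define H where "H x = d n x * (if \<forall>k\<le>n. u k x < c then 1 else 0)" for x
    have H_meas: "H \<in> borel_measurable (Pi\<^sub>M {1..n} (\<lambda>_. borel))"
    proof -
      have "Measurable.pred (Pi\<^sub>M {1..n} (\<lambda>_. borel)) (\<lambda>x. \<forall>k\<in>{..n}. u k x < c)"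
        by measurable
      then have "{x \<in> space (Pi\<^sub>M {1..n} (\<lambda>_. borel)). \<forall>k\<le>n. u k x < c} \<in> sets (Pi\<^sub>M {1..n} (\<lambda>_. borel))"
        by (simp only: pred_def Ball_def atMost_iff)
      then show ?thesis
        unfolding H_def[abs_def]
        by (intro borel_measurable_times d_meas measurable_If measurable_const) (simp_all only: space_borel UNIV_I)
    qed
    have H_eq: "H (\<lambda>k\<in>{1..n}. Y k \<omega>) = d n (\<lambda>k. Y k \<omega>) * (if \<forall>k\<le>n. U k \<omega> < c then 1 else 0)" for \<omega>
    proof -
      have "(\<forall>k\<le>n. u k (\<lambda>k\<in>{1..n}. Y k \<omega>) < c) = (\<forall>k\<le>n. U k \<omega> < c)"
        by (intro all_cong) (simp only: U_def u_restr)
      then show ?thesis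
        by (simp only: H_def d_restr)
    qed
    have "integrable M (\<lambda>\<omega>. H (\<lambda>k\<in>{1..n}. Y k \<omega>))"
    proof (rule integrable_const_bound[of _ "2 ^ n * measure \<nu> (space \<nu>)"])
      show "AE \<omega> in M. norm (H (\<lambda>k\<in>{1..n}. Y k \<omega>)) \<le> 2 ^ n * measure \<nu> (space \<nu>)"
        unfolding H_eq using D_bound[of n] by (intro AE_I2) (auto split: if_split)
    qed (rule measurable_compose[OF restr H_meas])
    moreover have "integrable M (Y (Suc n))"
      by (rule integrable_const_bound[of _ 1]) (use bnd in auto)
    ultimately have "expectation (\<lambda>\<omega>. H (\<lambda>k\<in>{1..n}. Y k \<omega>) * Y (Suc n) \<omega>) = 0"
      by (intro expectation_past_times_next[OF indep H_meas] mean) auto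
    then show ?thesis
      unfolding H_eq U_Suc by (simp only: mult.assoc mult.commute mult.left_commute)
  qed
  have "prob {\<omega> \<in> space M. \<exists>n. c \<le> U n \<omega>} \<le> expectation (U 0) / c"
    by (rule nonneg_maximal_inequality[OF int_U U_nonneg c step])
  \<comment> \<open>\<open>U 0\<close> is constantly the total mass of \<open>\<nu>\<close>, because
    the empty product is 1.\<close>
  then show "prob {\<omega> \<in> space M. \<exists>n. c \<le> (\<integral>l. (\<Prod>k=1..n. 1 + l * Y k \<omega>) \<partial>\<nu>)} \<le> measure \<nu> (space \<nu>) / c"
    by (simp add: U_def[abs_def] u_def prob_space)
  show "(\<lambda>\<omega>. \<integral>l. (\<Prod>k=1..n. 1 + l * Y k \<omega>) \<partial>\<nu>) \<in> borel_measurable M"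
    using U_meas[of n] by (simp add: U_def[abs_def] u_def[abs_def])
qed

section \<open>Exponential bound for bets away from zero\<close>

text \<open>The quotient \<open>f\<close> of the two sides has derivative of the sign of
  \<open>t * (t - 2)\<close>, so on \<open>{-1..1}\<close> it rises up to 0, falls afterwards, and
  is at most \<open>f 0 = 1\<close>.\<close>

lemma one_plus_le_exp_quadratic:
  fixes x :: real
  assumes "\<bar>x\<bar> \<le> 1"
  shows "1 + x \<le> exp (x - x\<^sup>2 / 6)"
proof -
  define f where "f t = (1 + t) * exp (t\<^sup>2 / 6 - t)" for t :: real
  have deriv: "(f has_real_derivative exp (t\<^sup>2 / 6 - t) * (t * (t - 2) / 3)) (at t)" for t
    unfolding f_def
    by (auto intro!: derivative_eq_intros simp: field_simps power2_eq_square)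
  have "f x \<le> f 0"
  proof (cases "x \<ge> 0")
    case True
    then show ?thesis
      using assms
      by (intro DERIV_nonpos_imp_nonincreasing[of 0 x f])
        (auto intro!: exI[of "\<lambda>D. (f has_real_derivative D) (at t) \<and> D \<le> 0" for t, OF conjI[OF deriv]]
          simp: mult_le_0_iff)
  next
    case False
    then show ?thesis
      using assms
      by (intro DERIV_nonneg_imp_nondecreasing[of x 0 f])
        (auto intro!: exI[of "\<lambda>D. (f has_real_derivative D) (at t) \<and> D \<ge> 0" for t, OF conjI[OF deriv]]
          simp: zero_le_mult_iff)
  qed
  then have "(1 + x) * exp (- (x - x\<^sup>2 / 6)) \<le> 1"
    by (simp add: f_def)
  then show ?thesis
    unfolding exp_minus by (simp add: field_simps)
qed

text \<open>The bound is uniform in \<open>l\<close>: the linear term is estimated with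
  \<open>\<bar>l\<bar> \<le> 1\<close> and the quadratic one with
  \<open>\<delta> \<le> \<bar>l\<bar>\<close>.\<close>

lemma prod_one_plus_le_exp:
  fixes l :: real and n :: nat
  assumes l: "\<delta> \<le> \<bar>l\<bar>" "\<bar>l\<bar> \<le> 1" "0 \<le> \<delta>" and y: "\<And>k. \<bar>y k\<bar> \<le> 1"
  shows "(\<Prod>k=1..n. 1 + l * y k) \<le> exp (\<bar>\<Sum>k=1..n. y k\<bar> - \<delta>\<^sup>2 / 6 * (\<Sum>k=1..n. (y k)\<^sup>2))"
proof -
  have ly: "\<bar>l * y k\<bar> \<le> 1" for k
    using l y by (simp add: abs_mult mult_le_one)
  have "(\<Prod>k=1..n. 1 + l * y k) \<le> (\<Prod>k=1..n. exp (l * y k - (l * y k)\<^sup>2 / 6))"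
  proof (rule prod_mono)
    fix k
    show "0 \<le> 1 + l * y k \<and> 1 + l * y k \<le> exp (l * y k - (l * y k)\<^sup>2 / 6)"
      using one_plus_le_exp_quadratic[OF ly[of k]] ly[of k] by linarith
  qed
  also have "\<dots> = exp (\<Sum>k=1..n. l * y k - (l * y k)\<^sup>2 / 6)"
    by (rule exp_sum[symmetric]) simp
  also have "\<dots> = exp (l * (\<Sum>k=1..n. y k) - l\<^sup>2 / 6 * (\<Sum>k=1..n. (y k)\<^sup>2))"
    by (simp add: sum_distrib_left power_mult_distrib sum_subtractf)
  also have "\<dots> \<le> exp (\<bar>\<Sum>k=1..n. y k\<bar> - \<delta>\<^sup>2 / 6 * (\<Sum>k=1..n. (y k)\<^sup>2))"
  proof -
    have "l * (\<Sum>k=1..n. y k) \<le> \<bar>l\<bar> * \<bar>\<Sum>k=1..n. y k\<bar>"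
      by (metis abs_ge_self abs_mult)
    also have "\<dots> \<le> \<bar>\<Sum>k=1..n. y k\<bar>"
      using l(2) by (simp add: mult_left_le_one_le)
    finally have "l * (\<Sum>k=1..n. y k) \<le> \<bar>\<Sum>k=1..n. y k\<bar>" .
    moreover have "\<delta>\<^sup>2 \<le> l\<^sup>2"
      using l by (simp add: abs_le_square_iff[symmetric])
    then have "\<delta>\<^sup>2 / 6 * (\<Sum>k=1..n. (y k)\<^sup>2) \<le> l\<^sup>2 / 6 * (\<Sum>k=1..n. (y k)\<^sup>2)"
      by (intro mult_right_mono sum_nonneg) auto
    ultimately show ?thesis
      unfolding exp_le_cancel_iff by (rule diff_mono)
  qed
  finally show ?thesis .
qed

section \<open>A strong law for bounded independent variables\<close>

text \<open>Hoeffding's inequality makes the deviation probabilities decay geometrically, and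
  Borel-Cantelli is applied for each accuracy \<open>1 / (j + 1)\<close>.\<close>

lemma (in prob_space) strong_law_bounded:
  fixes Z :: "nat \<Rightarrow> 'a \<Rightarrow> real"
  assumes indep: "indep_vars (\<lambda>_. borel) Z {1..}"
    and bnd: "\<And>k \<omega>. \<bar>Z k \<omega>\<bar> \<le> 1" and mean: "\<And>k. k \<ge> 1 \<Longrightarrow> expectation (Z k) = \<mu>"
  shows "AE \<omega> in M. (\<lambda>n. (\<Sum>k=1..n. Z k \<omega>) / n) \<longlonglongrightarrow> \<mu>"
proof -
  have Z[measurable]: "Z k \<in> borel_measurable M" if "k \<ge> 1" for k
    using indep that by (auto simp: indep_vars_def)
  have "AE \<omega> in M. eventually (\<lambda>n. \<bar>(\<Sum>k=1..n. Z k \<omega>) / n - \<mu>\<bar> < inverse (real (Suc j))) sequentially" for j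
  proof -
    define \<epsilon> where "\<epsilon> = inverse (real (Suc j))"
    have \<epsilon>: "\<epsilon> > 0" by (simp add: \<epsilon>_def)
    define A where "A n = {\<omega> \<in> space M. \<epsilon> * n \<le> \<bar>(\<Sum>k\<in>{1..n}. Z k \<omega>) - n * \<mu>\<bar>}" for n :: nat
    have [measurable]: "A n \<in> events" for n
      unfolding A_def by measurable
    have le: "prob (A n) \<le> 2 * exp (- (\<epsilon>\<^sup>2 / 2)) ^ n" for n
    \<comment> \<open>Hoeffding's inequality needs a nonempty index set; at \<open>n = 0\<close> the
      claimed bound is 2 and exceeds any probability.\<close>
    proof (cases "n = 0")
      case True
      then show ?thesis
        using prob_le_1[of "A n"] by (smt (verit) power_0)
    next
      case False
      interpret Hoeffding_ineq M "{1..n}" Z "\<lambda>_. -1" "\<lambda>_. 1" "n * \<mu>"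
      proof unfold_locales
        show "indep_vars (\<lambda>_. borel) Z {1..n}"
          by (rule indep_vars_subset[OF indep]) auto
        show "AE x in M. Z i x \<in> {- 1..1}" for i
          using bnd[of i] by (auto simp: abs_le_iff minus_le_iff)
        show "real n * \<mu> \<equiv> \<Sum>i = 1..n. expectation (Z i)"
          by (simp add: mean)
      qed simp
      have "prob (A n) \<le> 2 * exp (-2 * (\<epsilon> * n)\<^sup>2 / (\<Sum>i\<in>{1..n}. (1 - (-1))\<^sup>2))"
        unfolding A_def using False \<epsilon> by (intro Hoeffding_ineq_abs_ge) auto
      \<comment> \<open>Each variable ranges over an interval of length 2, so the denominator is
        \<open>4 * n\<close> and the exponent is linear in \<open>n\<close>.\<close>
      also have "-2 * (\<epsilon> * n)\<^sup>2 / (\<Sum>i\<in>{1..n}. (1 - (-1))\<^sup>2) = n * (- (\<epsilon>\<^sup>2 / 2))"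
        using False by (simp add: power2_eq_square)
      finally show ?thesis
        by (simp only: exp_of_nat_mult)
    qed
    have "AE \<omega> in M. eventually (\<lambda>n. \<omega> \<in> space M - A n) sequentially"
    proof (rule borel_cantelli_AE1)
      have "summable (\<lambda>n. 2 * exp (- (\<epsilon>\<^sup>2 / 2)) ^ n)"
        using \<epsilon> by (intro summable_mult summable_geometric) auto
      then show "summable (\<lambda>n. prob (A n))"
        by (rule summable_comparison_test') (use le in auto)
    qed (auto simp: less_top[symmetric])
    then show ?thesis
    proof (rule AE_mp, intro AE_I2 impI)
      fix \<omega> assume "\<omega> \<in> space M" "eventually (\<lambda>n. \<omega> \<in> space M - A n) sequentially"
      from this(2) eventually_gt_at_top[of 0]
      show "eventually (\<lambda>n. \<bar>(\<Sum>k=1..n. Z k \<omega>) / n - \<mu>\<bar> < inverse (real (Suc j))) sequentially"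
      proof eventually_elim
        case (elim n)
        then have "\<bar>(\<Sum>k=1..n. Z k \<omega>) - n * \<mu>\<bar> < \<epsilon> * n"
          by (auto simp: A_def)
        moreover have "(\<Sum>k=1..n. Z k \<omega>) / n - \<mu> = ((\<Sum>k=1..n. Z k \<omega>) - n * \<mu>) / n"
          using elim by (simp add: field_simps)
        ultimately show ?case
          using elim by (simp add: abs_divide pos_divide_less_eq \<epsilon>_def)
      qed
    qed
  qed
  then have "AE \<omega> in M. \<forall>j. eventually (\<lambda>n. \<bar>(\<Sum>k=1..n. Z k \<omega>) / n - \<mu>\<bar> < inverse (real (Suc j))) sequentially"
    by (simp add: AE_all_countable)
  then show ?thesis
  proof eventually_elim
    case (elim \<omega>)
    show ?case
    proof (rule tendstoI)
      fix e :: real assume "e > 0"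
      then obtain j where "inverse (real (Suc j)) < e"
        using reals_Archimedean by blast
      then show "\<forall>\<^sub>F n in sequentially. dist ((\<Sum>k=1..n. Z k \<omega>) / n) \<mu> < e"
        using elim[rule_format, of j] by (auto simp: dist_real_def elim!: eventually_mono)
    qed
  qed
qed

section \<open>The two mixing measures: finite, carried by \<open>{-1..1}\<close>, without atom at
  0\<close>

lemma finite_measure_rescaled_beta:
  assumes "a > 0" "b > 0"
  shows "finite_measure (rescaled_beta a b)" "AE l in rescaled_beta a b. \<bar>l\<bar> \<le> 1"
    "emeasure (rescaled_beta a b) {0} = 0"
proof -
  have meas[measurable]: "beta_density a b \<in> borel_measurable borel"
    unfolding beta_density_def[abs_def] by measurable
  have Beta_pos: "Beta a b > 0"
    using assms by (simp add: Beta_def Gamma_real_pos)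
  have nonneg: "beta_density a b x \<ge> 0" for x
    using Beta_pos by (auto simp: beta_density_def indicator_def)
  have "((\<lambda>t. t powr (a - 1) * (1 - t) powr (b - 1) / Beta a b) has_integral Beta a b / Beta a b) {0<..<1}"
    using has_integral_divide[OF has_integral_Beta_real[OF assms], of "Beta a b"]
    by (simp only: has_integral_Icc_iff_Ioo)
  then have "((\<lambda>t. if t \<in> {0<..<1} then t powr (a - 1) * (1 - t) powr (b - 1) / Beta a b else 0) has_integral 1) UNIV"
    using Beta_pos by (subst has_integral_restrict_UNIV) simp
  also have "(\<lambda>t. if t \<in> {0<..<1} then t powr (a - 1) * (1 - t) powr (b - 1) / Beta a b else 0) = beta_density a b"
    by (auto simp: beta_density_def indicator_def)
  finally have "(\<integral>\<^sup>+x. ennreal (beta_density a b x) \<partial>lborel) = 1"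
    using nn_integral_has_integral_lborel[OF meas nonneg] by simp
  then have "emeasure (beta_distribution a b) (space (beta_distribution a b)) = 1"
    by (simp add: beta_distribution_def emeasure_density)
  then interpret B: prob_space "beta_distribution a b"
    by (rule prob_spaceI)
  have sets_B[measurable_cong]: "sets (beta_distribution a b) = sets borel"
    by (simp add: beta_distribution_def)
  interpret R: prob_space "rescaled_beta a b"
    unfolding rescaled_beta_def by (rule B.prob_space_distr) measurable
  show "finite_measure (rescaled_beta a b)"
    by unfold_locales
  have "AE x in beta_distribution a b. \<bar>2 * x - 1\<bar> \<le> 1"
    unfolding beta_distribution_def
    by (subst AE_density) (auto simp: beta_density_def indicator_def)
  then show "AE l in rescaled_beta a b. \<bar>l\<bar> \<le> 1"
    unfolding rescaled_beta_def by (subst AE_distr_iff) (auto simp: beta_distribution_def)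
  have "emeasure (rescaled_beta a b) {0} = emeasure (beta_distribution a b) {1 / 2}"
    unfolding rescaled_beta_def
    by (subst emeasure_distr) (auto simp: beta_distribution_def intro!: arg_cong[where f = "emeasure _"])
  also have "\<dots> = 0"
    unfolding beta_distribution_def
    by (subst emeasure_density) (simp_all add: nn_integral_null_set finite_imp_null_set_lborel)
  finally show "emeasure (rescaled_beta a b) {0} = 0" .
qed

text \<open>The constant exceeds \<open>exp 1\<close>, so the inner logarithm stays above 1 on the
  whole range and the iterated logarithm has no zero there.\<close>

lemma robbins_ln_ln_pos:
  assumes "0 < x" "x \<le> 1"
  shows "ln (robbins_const / x) > 1" "ln (ln (robbins_const / x)) > 0"
proof -
  have "exp 1 < robbins_const"
    by (simp add: robbins_const_def)
  also have "robbins_const \<le> robbins_const / x"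
    using assms by (simp add: robbins_const_def field_simps)
  finally have "ln (exp 1) < ln (robbins_const / x)"
    using assms by (subst ln_less_cancel_iff) (auto simp: robbins_const_def)
  then show "ln (robbins_const / x) > 1"
    by simp
  then show "ln (ln (robbins_const / x)) > 0"
    by simp
qed

lemma robbins_density_nonneg: "robbins_density x \<ge> 0"
proof (cases "x \<noteq> 0 \<and> \<bar>x\<bar> \<le> 1")
  case True
  with robbins_ln_ln_pos[of "\<bar>x\<bar>"] robbins_ln_ln_pos[of 1] show ?thesis
    by (auto simp: robbins_density_def indicator_def intro!: divide_nonneg_nonneg mult_nonneg_nonneg)
qed (auto simp: robbins_density_def)

text \<open>The density has the explicit antiderivative \<open>F\<close> on the open unit interval.
  The iterated logarithm tends to infinity at 0, so \<open>F\<close> tends to 0 there, while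
  \<open>F 1\<close> is \<open>1 / 2\<close>; a nonnegative function with such an antiderivative is
  integrable.\<close>

lemma set_integrable_robbins_density: "set_integrable lborel {0<..<1} robbins_density"
proof -
  define F where "F x = ln (ln robbins_const) / (2 * ln (ln (robbins_const / x)))" for x :: real
  define f where "f x = ln (ln robbins_const) /
     (2 * x * ln (robbins_const / x) * (ln (ln (robbins_const / x)))\<^sup>2)" for x :: real
  have C: "robbins_const > 0"
    by (simp add: robbins_const_def)
  have deriv: "(F has_real_derivative f x) (at x)" if "0 < x" "x < 1" for x
  proof -
    have *: "robbins_const / x > 0" "ln (robbins_const / x) > 1" "ln (ln (robbins_const / x)) > 0"
      using C that robbins_ln_ln_pos[of x] by auto
    have "((\<lambda>x. ln (robbins_const / x)) has_real_derivative - (1 / x)) (at x)"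
      using * that C by (auto intro!: derivative_eq_intros simp: field_simps)
    from DERIV_chain2[OF DERIV_ln this]
    have "((\<lambda>x. ln (ln (robbins_const / x))) has_real_derivative
        inverse (ln (robbins_const / x)) * - (1 / x)) (at x)"
      using * by linarith
    from DERIV_divide[OF DERIV_const[of "ln (ln robbins_const)"] DERIV_cmult[OF this, of 2]]
    have "(F has_real_derivative
        (0 * (2 * ln (ln (robbins_const / x))) - ln (ln robbins_const) * (2 * (inverse (ln (robbins_const / x)) * - (1 / x))))
        / (2 * ln (ln (robbins_const / x)) * (2 * ln (ln (robbins_const / x))))) (at x)"
      unfolding F_def using * by simp
    also have "(0 * (2 * ln (ln (robbins_const / x))) - ln (ln robbins_const) * (2 * (inverse (ln (robbins_const / x)) * - (1 / x))))
        / (2 * ln (ln (robbins_const / x)) * (2 * ln (ln (robbins_const / x)))) = f x"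
      using * that unfolding f_def by (simp add: divide_simps power2_eq_square)
    finally show ?thesis .
  qed
  have cont: "isCont f x" if "0 < x" "x < 1" for x
  proof -
    have *: "robbins_const / x > 0" "ln (robbins_const / x) > 1" "ln (ln (robbins_const / x)) > 0"
      using C that robbins_ln_ln_pos[of x] by auto
    show ?thesis
      unfolding f_def by (intro continuous_intros) (use * that C in auto)
  qed
  have f_nonneg: "f x \<ge> 0" if "0 < x" "x < 1" for x
    using robbins_density_nonneg[of x] that by (simp add: f_def robbins_density_def)
  have "set_integrable lborel (einterval 0 1) f"
  proof (rule interval_integral_FTC_nonneg(1))
    show "((F \<circ> real_of_ereal) \<longlongrightarrow> 0) (at_right 0)"
    proof -
      have "filterlim (\<lambda>x. robbins_const / x) at_top (at_right 0)"
        unfolding divide_inverse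
        using C by (intro filterlim_tendsto_pos_mult_at_top[OF tendsto_const] filterlim_inverse_at_top_right)
      then have "filterlim (\<lambda>x. 2 * ln (ln (robbins_const / x))) at_top (at_right 0)"
        by (intro filterlim_tendsto_pos_mult_at_top[OF tendsto_const] filterlim_compose[OF ln_at_top]) auto
      then have "(F \<longlongrightarrow> 0) (at_right 0)"
        unfolding F_def by (intro tendsto_divide_0[OF tendsto_const] filterlim_at_top_imp_at_infinity)
      then show ?thesis
        by (simp add: ereal_tendsto_simps zero_ereal_def)
    qed
    show "((F \<circ> real_of_ereal) \<longlongrightarrow> F 1) (at_left 1)"
    proof -
      have "isCont F 1"
        unfolding F_def using robbins_ln_ln_pos[of 1] C
        by (intro continuous_intros) auto
      then have "(F \<longlongrightarrow> F 1) (at_left 1)"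
        by (auto simp: isCont_def intro: tendsto_mono[OF at_le[OF subset_UNIV]])
      then show ?thesis
        by (simp add: ereal_tendsto_simps one_ereal_def)
    qed
  qed (use deriv cont f_nonneg in auto)
  also have "einterval 0 1 = {0<..<1::real}"
    by (auto simp: einterval_def)
  also have "set_integrable lborel {0<..<1} f \<longleftrightarrow> set_integrable lborel {0<..<1} robbins_density"
    by (intro set_integrable_cong) (auto simp: robbins_density_def f_def)
  finally show ?thesis .
qed

lemma finite_measure_robbins_mixture:
  "finite_measure robbins_mixture" "AE l in robbins_mixture. \<bar>l\<bar> \<le> 1"
  "emeasure robbins_mixture {0} = 0"
proof -
  have meas[measurable]: "robbins_density \<in> borel_measurable borel"
    unfolding robbins_density_def[abs_def] by measurable
  have pos: "integrable lborel (\<lambda>x. indicator {0<..<1} x * robbins_density x)"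
    using set_integrable_robbins_density by (simp add: set_integrable_def)
  \<comment> \<open>The density is even; the reflection \<open>x \<mapsto> - x\<close> carries
    integrability over to the negative half.\<close>
  have "integrable lborel (\<lambda>x. indicator {0<..<1} (0 + (-1) * x) * robbins_density (0 + (-1) * x))"
    by (rule lborel_integrable_real_affine[OF pos]) simp
  then have "integrable lborel (\<lambda>x. indicator {0<..<1} (- x) * robbins_density (- x))"
    by simp
  then have "integrable lborel (\<lambda>x. indicator {0<..<1} x * robbins_density x + indicator {0<..<1} (- x) * robbins_density (- x))"
    using pos by (rule Bochner_Integration.integrable_add[rotated])
  moreover have "AE x in lborel. indicator {0<..<1} x * robbins_density x + indicator {0<..<1} (- x) * robbins_density (- x) = robbins_density x"
  proof -
    \<comment> \<open>These are the points of \<open>{-1..1}\<close> that the two open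
      half-intervals miss.\<close>
    have "AE x in lborel. x \<notin> {-1, 0, 1::real}"
      by (rule AE_not_in) (auto intro!: finite_imp_null_set_lborel)
    then show ?thesis
      by eventually_elim (auto simp: robbins_density_def indicator_def)
  qed
  ultimately have "integrable lborel robbins_density"
    by (subst (asm) integrable_cong_AE) auto
  then have "emeasure robbins_mixture (space robbins_mixture) \<noteq> \<infinity>"
    using robbins_density_nonneg
    by (simp add: robbins_mixture_def emeasure_density nn_integral_eq_integral)
  then show "finite_measure robbins_mixture"
    by (rule finite_measureI)
  show "AE l in robbins_mixture. \<bar>l\<bar> \<le> 1"
    unfolding robbins_mixture_def by (subst AE_density) (auto simp: robbins_density_def indicator_def)
  show "emeasure robbins_mixture {0} = 0"
    unfolding robbins_mixture_def
    by (subst emeasure_density) (simp_all add: nn_integral_null_set finite_imp_null_set_lborel)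
qed

section \<open>Convergence of the mixture to zero\<close>

text \<open>Once both strong laws hold at a sample point, the rest is deterministic: the sum of
  squares grows linearly and outweighs the sublinear sum in the exponent.\<close>

lemma (in prob_space) large_bet_mixture_tendsto_0:
  fixes Y :: "nat \<Rightarrow> 'a \<Rightarrow> real" and \<pi> :: "real measure"
  assumes indep: "indep_vars (\<lambda>_. borel) Y {1..}"
    and bnd: "\<And>k \<omega>. \<bar>Y k \<omega>\<bar> \<le> 1" and mean: "\<And>k. k \<ge> 1 \<Longrightarrow> expectation (Y k) = 0"
    and var: "\<And>k. k \<ge> 1 \<Longrightarrow> expectation (\<lambda>\<omega>. (Y k \<omega>)\<^sup>2) = v" and v: "v > 0"
    and fin: "finite_measure \<pi>" and sets: "sets \<pi> = sets borel" and AE1: "AE l in \<pi>. \<bar>l\<bar> \<le> 1"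
    and \<delta>: "\<delta> > 0"
  shows "AE \<omega> in M. (\<lambda>n. \<integral>l. indicator {l. \<delta> \<le> \<bar>l\<bar>} l * (\<Prod>k=1..n. 1 + l * Y k \<omega>) \<partial>\<pi>) \<longlonglongrightarrow> 0"
proof -
  interpret \<pi>: finite_measure \<pi> by fact
  have "AE \<omega> in M. (\<lambda>n. (\<Sum>k=1..n. Y k \<omega>) / n) \<longlonglongrightarrow> 0"
    by (rule strong_law_bounded[OF indep bnd mean])
  moreover have "AE \<omega> in M. (\<lambda>n. (\<Sum>k=1..n. (Y k \<omega>)\<^sup>2) / n) \<longlonglongrightarrow> v"
  proof (rule strong_law_bounded)
    show "indep_vars (\<lambda>_. borel) (\<lambda>k \<omega>. (Y k \<omega>)\<^sup>2) {1..}"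
      by (rule indep_vars_compose2[OF indep]) measurable
    show "\<bar>(Y k \<omega>)\<^sup>2\<bar> \<le> 1" for k \<omega>
      using bnd[of k \<omega>] by (simp add: abs_square_le_1)
  qed (rule var)
  ultimately show ?thesis
  proof eventually_elim
    case (elim \<omega>)
    define e where "e n = \<bar>\<Sum>k=1..n. Y k \<omega>\<bar> - \<delta>\<^sup>2 / 6 * (\<Sum>k=1..n. (Y k \<omega>)\<^sup>2)" for n
    define I where "I n = (\<integral>l. indicator {l. \<delta> \<le> \<bar>l\<bar>} l * (\<Prod>k=1..n. 1 + l * Y k \<omega>) \<partial>\<pi>)" for n
    have nonneg: "AE l in \<pi>. 0 \<le> (\<Prod>k=1..n. 1 + l * Y k \<omega>)" for n :: nat
      using AE1 by eventually_elim (rule prod_one_plus_bounds(1)[OF _ bnd])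
    have I_nonneg: "0 \<le> I n" for n
      unfolding I_def
      by (intro integral_nonneg_AE eventually_mono[OF nonneg[of n]]) (simp add: indicator_def)
    have I_le: "I n \<le> exp (e n) * measure \<pi> (space \<pi>)" for n
    proof -
      have "I n \<le> (\<integral>l. exp (e n) \<partial>\<pi>)"
        unfolding I_def
      proof (rule integral_mono_AE)
        show "integrable \<pi> (\<lambda>l. indicator {l. \<delta> \<le> \<bar>l\<bar>} l * (\<Prod>k=1..n. 1 + l * Y k \<omega>))"
          by (rule integrable_prod_one_plus(1)[OF fin sets AE1 bnd]) (auto simp: indicator_def)
        show "AE l in \<pi>. indicator {l. \<delta> \<le> \<bar>l\<bar>} l * (\<Prod>k=1..n. 1 + l * Y k \<omega>) \<le> exp (e n)"
          using AE1
        proof eventually_elim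
          case (elim l)
          then show ?case
            using prod_one_plus_le_exp[of \<delta> l "\<lambda>k. Y k \<omega>" n] \<delta> bnd
            by (auto simp: e_def indicator_def)
        qed
      qed simp
      then show ?thesis
        by (simp add: mult.commute)
    qed
    \<comment> \<open>The exponent per step tends to a strictly negative rate, which drives
      \<open>e\<close> itself to minus infinity.\<close>
    have "(\<lambda>n. \<bar>(\<Sum>k=1..n. Y k \<omega>) / n\<bar> - \<delta>\<^sup>2 / 6 * ((\<Sum>k=1..n. (Y k \<omega>)\<^sup>2) / n)) \<longlonglongrightarrow> \<bar>0\<bar> - \<delta>\<^sup>2 / 6 * v"
      by (intro tendsto_intros elim)
    then have "(\<lambda>n. e n / n) \<longlonglongrightarrow> - (\<delta>\<^sup>2 / 6 * v)"
      by (simp add: e_def diff_divide_distrib)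
    then have "filterlim (\<lambda>n. e n / n * n) at_bot sequentially"
      by (rule filterlim_tendsto_neg_mult_at_bot[OF _ _ filterlim_real_sequentially])
        (use \<delta> v in simp)
    \<comment> \<open>This includes \<open>n = 0\<close>: the left side is 0 there by division by
      zero, and \<open>e 0\<close> is 0 because its sums are empty.\<close>
    also have "(\<lambda>n. e n / n * n) = e"
      by (auto simp: e_def)
    finally have "filterlim e at_bot sequentially" .
    then have "(\<lambda>n. exp (e n) * measure \<pi> (space \<pi>)) \<longlonglongrightarrow> 0"
      by (intro tendsto_mult_left_zero filterlim_compose[OF exp_at_bot])
    from tendsto_sandwich[OF _ _ tendsto_const this, of I] have "I \<longlonglongrightarrow> 0"
      using I_nonneg I_le by auto
    then show ?case
      by (simp only: I_def[abs_def])
  qed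
qed

text \<open>The cut is taken along a sequence shrinking to 0. The cut that works depends on the
  sample point and the tolerance but not on \<open>n\<close>, so the large part can then be sent to
  0 with the cut fixed.\<close>

lemma (in prob_space) mixture_tendsto_0:
  fixes Y :: "nat \<Rightarrow> 'a \<Rightarrow> real" and \<pi> :: "real measure"
  assumes indep: "indep_vars (\<lambda>_. borel) Y {1..}"
    and bnd: "\<And>k \<omega>. \<bar>Y k \<omega>\<bar> \<le> 1" and mean: "\<And>k. k \<ge> 1 \<Longrightarrow> expectation (Y k) = 0"
    and var: "\<And>k. k \<ge> 1 \<Longrightarrow> expectation (\<lambda>\<omega>. (Y k \<omega>)\<^sup>2) = v" and v: "v > 0"
    and fin: "finite_measure \<pi>" and sets: "sets \<pi> = sets borel" and AE1: "AE l in \<pi>. \<bar>l\<bar> \<le> 1"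
    and no_atom: "emeasure \<pi> {0} = 0"
  shows "AE \<omega> in M. (\<lambda>n. \<integral>l. (\<Prod>k=1..n. 1 + l * Y k \<omega>) \<partial>\<pi>) \<longlonglongrightarrow> 0"
proof -
  interpret \<pi>: finite_measure \<pi> by fact
  note [measurable_cong] = sets
  have space: "space \<pi> = UNIV"
    using sets_eq_imp_space_eq[OF sets] by simp
  \<comment> \<open>The same sequence serves twice: as cut points for \<open>l\<close> and as
    tolerances for the limit.\<close>
  define \<delta> where "\<delta> i = inverse (real (Suc i))" for i
  define S where "S i = {l. \<bar>l\<bar> < \<delta> i}" for i
  have S_sets[measurable]: "S i \<in> sets borel" for i
    unfolding S_def by measurable
  \<comment> \<open>Restricting \<open>\<pi>\<close> by a density keeps the Borel sets, and the
    total mass becomes the mass of \<open>S i\<close>, which is what the maximal inequality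
    sees.\<close>
  define \<nu> where "\<nu> i = density \<pi> (\<lambda>l. ennreal (indicator (S i) l))" for i
  have sets_\<nu>: "sets (\<nu> i) = sets borel" for i
    by (simp add: \<nu>_def sets)
  have emeasure_\<nu>: "emeasure (\<nu> i) (space (\<nu> i)) = emeasure \<pi> (S i)" for i
    by (simp add: \<nu>_def emeasure_density space ennreal_indicator S_sets sets)
  have fin_\<nu>: "finite_measure (\<nu> i)" for i
    by (rule finite_measureI) (simp add: emeasure_\<nu>)
  have AE1_\<nu>: "AE l in \<nu> i. \<bar>l\<bar> \<le> 1" for i
    unfolding \<nu>_def by (subst AE_density) (auto intro!: eventually_mono[OF AE1])
  define small where "small i n \<omega> = (\<integral>l. (\<Prod>k=1..n. 1 + l * Y k \<omega>) \<partial>\<nu> i)" for i and n :: nat and \<omega>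
  define big where "big i n \<omega> = (\<integral>l. indicator {l. \<delta> i \<le> \<bar>l\<bar>} l * (\<Prod>k=1..n. 1 + l * Y k \<omega>) \<partial>\<pi>)" for i and n :: nat and \<omega>
  have split: "(\<integral>l. (\<Prod>k=1..n. 1 + l * Y k \<omega>) \<partial>\<pi>) = small i n \<omega> + big i n \<omega>" for i n \<omega>
  proof -
    have int: "integrable \<pi> (\<lambda>l. indicator {l. \<delta> i \<le> \<bar>l\<bar>} l * (\<Prod>k=1..n. 1 + l * Y k \<omega>))"
      "integrable \<pi> (\<lambda>l. indicator (S i) l * (\<Prod>k=1..n. 1 + l * Y k \<omega>))"
      by (rule integrable_prod_one_plus(1)[OF fin sets AE1 bnd]; auto simp: indicator_def)+
    have "small i n \<omega> = (\<integral>l. indicator (S i) l * (\<Prod>k=1..n. 1 + l * Y k \<omega>) \<partial>\<pi>)"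
      unfolding small_def \<nu>_def by (subst integral_density) auto
    then have "small i n \<omega> + big i n \<omega> = (\<integral>l. indicator (S i) l * (\<Prod>k=1..n. 1 + l * Y k \<omega>)
        + indicator {l. \<delta> i \<le> \<bar>l\<bar>} l * (\<Prod>k=1..n. 1 + l * Y k \<omega>) \<partial>\<pi>)"
      using int by (simp add: big_def)
    also have "\<dots> = (\<integral>l. (\<Prod>k=1..n. 1 + l * Y k \<omega>) \<partial>\<pi>)"
      by (intro Bochner_Integration.integral_cong) (auto simp: S_def indicator_def)
    finally show ?thesis ..
  qed
  have nonneg: "0 \<le> (\<integral>l. (\<Prod>k=1..n. 1 + l * Y k \<omega>) \<partial>\<pi>)" for n :: nat and \<omega>
    by (intro integral_nonneg_AE eventually_mono[OF AE1] prod_one_plus_bounds(1) bnd)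
  \<comment> \<open>The intervals decrease to \<open>{0}\<close>, so the absence of an atom there
    enters at this point.\<close>
  have measure_S: "(\<lambda>i. measure \<pi> (S i)) \<longlonglongrightarrow> 0"
  proof -
    have "(\<lambda>i. measure \<pi> (S i)) \<longlonglongrightarrow> measure \<pi> (\<Inter>i. S i)"
    proof (rule \<pi>.finite_Lim_measure_decseq)
      show "decseq S"
        by (rule antimonoI) (auto simp: S_def \<delta>_def le_imp_inverse_le elim!: order.strict_trans2)
    qed (auto simp: sets S_sets)
    also have "(\<Inter>i. S i) = {0}"
    proof -
      have "x = 0" if "\<forall>i. \<bar>x\<bar> < inverse (real (Suc i))" for x
        using that reals_Archimedean[of "\<bar>x\<bar>"] by (metis less_asym zero_less_abs_iff)
      then show ?thesis
        by (auto simp: S_def \<delta>_def)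
    qed
    finally show ?thesis
      using no_atom by (simp add: measure_def)
  qed
  have big_0: "AE \<omega> in M. \<forall>i. (\<lambda>n. big i n \<omega>) \<longlonglongrightarrow> 0"
    unfolding AE_all_countable big_def
    by (intro allI large_bet_mixture_tendsto_0[OF indep bnd mean var v fin sets AE1]) (auto simp: \<delta>_def)
  \<comment> \<open>Failure means that for every cut the small part reaches \<open>c\<close> at some
    time. This lies in each \<open>E i\<close>, whose probability is at most
    \<open>measure \<pi> (S i) / c\<close>, hence it is a null event.\<close>
  have small_le: "AE \<omega> in M. \<exists>i. \<forall>n. small i n \<omega> < c" if c: "c > 0" for c
  proof -
    have meas[measurable]: "small i n \<in> borel_measurable M" for i n
      unfolding small_def[abs_def] by (rule mixture_maximal_inequality(2)[OF indep bnd mean fin_\<nu> sets_\<nu> AE1_\<nu> c])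
    define E where "E i = {\<omega> \<in> space M. \<exists>n. c \<le> small i n \<omega>}" for i
    have [measurable]: "E i \<in> events" for i
      unfolding E_def by measurable
    have "prob (\<Inter>i. E i) \<le> measure \<pi> (S i) / c" for i
    proof -
      have "prob (\<Inter>i. E i) \<le> prob (E i)"
        by (rule finite_measure_mono) auto
      also have "\<dots> \<le> measure (\<nu> i) (space (\<nu> i)) / c"
        unfolding E_def small_def
        by (rule mixture_maximal_inequality(1)[OF indep bnd mean fin_\<nu> sets_\<nu> AE1_\<nu> c])
      finally show ?thesis
        by (simp add: measure_def emeasure_\<nu>)
    qed
    moreover have "(\<lambda>i. measure \<pi> (S i) / c) \<longlonglongrightarrow> 0"
      using tendsto_divide[OF measure_S tendsto_const, of c] c by simp
    ultimately have "prob (\<Inter>i. E i) \<le> 0"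
      by (intro LIMSEQ_le_const) auto
    then have "prob (\<Inter>i. E i) = 0"
      by (simp add: measure_le_0_iff)
    then have "AE \<omega> in M. \<omega> \<notin> (\<Inter>i. E i)"
      by (subst (asm) prob_eq_0) auto
    then show ?thesis
      by (rule AE_mp) (auto simp: E_def not_le)
  qed
  have "AE \<omega> in M. \<forall>j. \<exists>i. \<forall>n. small i n \<omega> < \<delta> j"
    unfolding AE_all_countable by (intro allI small_le) (auto simp: \<delta>_def)
  with big_0 show ?thesis
  proof eventually_elim
    case (elim \<omega>)
    show ?case
    proof (rule tendstoI)
      fix e :: real assume "e > 0"
      then obtain j where j: "\<delta> j < e / 2"
        using reals_Archimedean[of "e / 2"] by (auto simp: \<delta>_def)
      obtain i where i: "\<And>n. small i n \<omega> < \<delta> j"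
        using elim(2) by blast
      have "eventually (\<lambda>n. big i n \<omega> < e / 2) sequentially"
        using elim(1) \<open>e > 0\<close> by (intro order_tendstoD(2)[of _ 0]) auto
      then show "\<forall>\<^sub>F n in sequentially. dist (\<integral>l. (\<Prod>k=1..n. 1 + l * Y k \<omega>) \<partial>\<pi>) 0 < e"
      proof eventually_elim
        case (elim n)
        have "small i n \<omega> + big i n \<omega> < e"
          using elim i[of n] j by linarith
        then show ?case
          using nonneg[of \<omega> n] split[of \<omega> n i] unfolding dist_real_def by linarith
      qed
    qed
  qed
qed

section \<open>From the law of the observations to bounded centred variables\<close>

text \<open>A vanishing second moment would force \<open>x = m\<close> almost everywhere and make
  \<open>P\<close> the point mass at \<open>m\<close>.\<close>

lemma second_moment_pos:
  fixes P :: "real measure"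
  assumes "prob_space P" "sets P = sets borel"
    and nondegenerate: "\<not> (\<exists>c. P = return borel c)"
    and int: "integrable P (\<lambda>x. (x - m)\<^sup>2)"
  shows "(\<integral>x. (x - m)\<^sup>2 \<partial>P) > 0"
proof (rule ccontr)
  interpret prob_space P by fact
  note [measurable_cong] = assms(2)
  assume "\<not> (\<integral>x. (x - m)\<^sup>2 \<partial>P) > 0"
  moreover have "(\<integral>x. (x - m)\<^sup>2 \<partial>P) \<ge> 0"
    by (rule Bochner_Integration.integral_nonneg) simp
  ultimately have "(\<integral>x. (x - m)\<^sup>2 \<partial>P) = 0"
    by linarith
  then have AE: "AE x in P. x = m"
    by (subst (asm) integral_nonneg_eq_0_iff_AE[OF int]) auto
  have "P = return borel m"
  proof (rule measure_eqI)
    fix A assume "A \<in> sets P"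
    then have A: "A \<in> sets borel" by (simp add: assms(2))
    have "emeasure P A = emeasure P (if m \<in> A then space P else {})"
      using A sets_eq_imp_space_eq[OF assms(2)]
      by (intro emeasure_eq_AE eventually_mono[OF AE]) (auto simp: assms(2))
    also have "\<dots> = emeasure (return borel m) A"
      using A by (simp add: emeasure_space_1)
    finally show "emeasure P A = emeasure (return borel m) A" .
  qed (simp add: assms(2))
  with nondegenerate show False by blast
qed

theorem proposition3p2:
  fixes M :: "'a measure" and P :: "real measure" and X :: "nat \<Rightarrow> 'a \<Rightarrow> real" and m :: real
  assumes "prob_space M"
    and "prob_space P" and "sets P = sets borel" and "AE x in P. x \<in> {0..1}"
    and nondegenerate: "\<not> (\<exists>c. P = return borel c)"
    and mean: "m = (\<integral>x. x \<partial>P)"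
    and indep: "prob_space.indep_vars M (\<lambda>_. borel) X {1..}"
    and law: "\<And>k. k \<ge> 1 \<Longrightarrow> distr M borel (X k) = P"
  shows "(\<forall>a b. a > 0 \<longrightarrow> b > 0 \<longrightarrow>
            (AE \<omega> in M. (\<lambda>n. mixture_wealth (rescaled_beta a b) m X n \<omega>) \<longlonglongrightarrow> 0))
       \<and> (AE \<omega> in M. (\<lambda>n. mixture_wealth robbins_mixture m X n \<omega>) \<longlonglongrightarrow> 0)"
proof -
  interpret prob_space M by fact
  interpret P: prob_space P by fact
  note [measurable_cong] = assms(3)
  have X[measurable]: "X k \<in> borel_measurable M" if "k \<ge> 1" for k
    using indep that by (auto simp: indep_vars_def)
  have int_id: "integrable P (\<lambda>x. x)"
    by (rule P.integrable_const_bound[of _ 1]) (auto intro!: eventually_mono[OF assms(4)])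
  have "m \<ge> 0"
    unfolding mean by (intro integral_nonneg_AE eventually_mono[OF assms(4)]) auto
  moreover have "m \<le> (\<integral>x. 1 \<partial>P)"
    unfolding mean by (intro integral_mono_AE int_id eventually_mono[OF assms(4)]) auto
  ultimately have m: "0 \<le> m" "m \<le> 1"
    by (auto simp: P.prob_space)
  \<comment> \<open>The centred observations lie in \<open>{-1..1}\<close> only almost surely,
    whereas the convergence lemma asks for the bound at every sample point. Truncation supplies it
    and changes nothing on \<open>{0..1}\<close>, since \<open>m\<close> lies there too.\<close>
  define clip where "clip x = max (- 1) (min 1 (x - m))" for x :: real
  have [measurable]: "clip \<in> borel_measurable borel"
    unfolding clip_def by measurable
  have clip: "clip x = x - m" if "x \<in> {0..1}" for x
    using that m by (auto simp: clip_def)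
  have AE_clip: "AE x in P. clip x = x - m"
    using assms(4) by eventually_elim (rule clip)
  have clip_bound: "\<bar>clip x\<bar> \<le> 1" for x
    by (auto simp: clip_def)
  have law_integral: "expectation (\<lambda>\<omega>. g (X k \<omega>)) = (\<integral>x. g x \<partial>P)"
    if "k \<ge> 1" "g \<in> borel_measurable borel" for k and g :: "real \<Rightarrow> real"
    using integral_distr[OF X[OF that(1)] that(2)] law[OF that(1)] by simp
  have int_sq: "integrable P (\<lambda>x. (x - m)\<^sup>2)"
  proof (rule P.integrable_const_bound[of _ 1])
    show "AE x in P. norm ((x - m)\<^sup>2) \<le> 1"
      using AE_clip
    proof eventually_elim
      case (elim x)
      then show ?case using clip_bound[of x] by (simp add: abs_square_le_1)
    qed
  qed measurable
  have tendsto: "AE \<omega> in M. (\<lambda>n. mixture_wealth \<pi> m X n \<omega>) \<longlonglongrightarrow> 0"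
    if \<pi>: "finite_measure \<pi>" "sets \<pi> = sets borel" "AE l in \<pi>. \<bar>l\<bar> \<le> 1" "emeasure \<pi> {0} = 0" for \<pi>
  proof -
    have "AE \<omega> in M. (\<lambda>n. \<integral>l. (\<Prod>k=1..n. 1 + l * clip (X k \<omega>)) \<partial>\<pi>) \<longlonglongrightarrow> 0"
    proof (rule mixture_tendsto_0[OF _ _ _ _ _ \<pi>])
      show "indep_vars (\<lambda>_. borel) (\<lambda>k \<omega>. clip (X k \<omega>)) {1..}"
        by (rule indep_vars_compose2[OF indep]) measurable
      show "expectation (\<lambda>\<omega>. clip (X k \<omega>)) = 0" if "k \<ge> 1" for k
      proof -
        have "expectation (\<lambda>\<omega>. clip (X k \<omega>)) = (\<integral>x. x - m \<partial>P)"
          unfolding law_integral[OF that \<open>clip \<in> _\<close>]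
          by (rule integral_cong_AE) (auto intro!: eventually_mono[OF AE_clip])
        also have "\<dots> = 0"
          using int_id by (simp add: mean P.prob_space)
        finally show ?thesis .
      qed
      show "expectation (\<lambda>\<omega>. (clip (X k \<omega>))\<^sup>2) = (\<integral>x. (x - m)\<^sup>2 \<partial>P)" if "k \<ge> 1" for k
      proof -
        have "expectation (\<lambda>\<omega>. (clip (X k \<omega>))\<^sup>2) = (\<integral>x. (clip x)\<^sup>2 \<partial>P)"
          by (rule law_integral[OF that]) measurable
        also have "\<dots> = (\<integral>x. (x - m)\<^sup>2 \<partial>P)"
          by (rule integral_cong_AE) (auto intro!: eventually_mono[OF AE_clip])
        finally show ?thesis .
      qed
      show "(\<integral>x. (x - m)\<^sup>2 \<partial>P) > 0"
        by (rule second_moment_pos[OF assms(2,3) nondegenerate int_sq])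
    qed (rule clip_bound)
    \<comment> \<open>Countably many null sets are joined, so truncated and original products agree
      for all \<open>n\<close> at once. The index starts at 1, as \<open>law\<close> does.\<close>
    moreover have "AE \<omega> in M. \<forall>k\<in>{1..}. clip (X k \<omega>) = X k \<omega> - m"
    proof (rule AE_ball_countable[THEN iffD2], simp, intro ballI)
      fix k :: nat assume "k \<in> {1..}"
      then have k: "k \<ge> 1" by simp
      have "AE x in distr M borel (X k). clip x = x - m"
        using AE_clip by (simp only: law[OF k])
      then show "AE \<omega> in M. clip (X k \<omega>) = X k \<omega> - m"
        using k by (subst (asm) AE_distr_iff) auto
    qed
    ultimately show ?thesis
    proof eventually_elim
      case (elim \<omega>)
      have "(\<Prod>k=1..n. 1 + l * clip (X k \<omega>)) = (\<Prod>k=1..n. 1 + l * (X k \<omega> - m))" for l n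
        using elim(2) by (intro prod.cong) auto
      with elim(1) show ?case
        by (simp only: mixture_wealth_def)
    qed
  qed
  show ?thesis
  proof (intro conjI allI impI)
    fix a b :: real assume "a > 0" "b > 0"
    note beta = finite_measure_rescaled_beta[OF this]
    show "AE \<omega> in M. (\<lambda>n. mixture_wealth (rescaled_beta a b) m X n \<omega>) \<longlonglongrightarrow> 0"
      by (rule tendsto[OF beta(1) _ beta(2,3)]) (simp add: rescaled_beta_def)
  next
    show "AE \<omega> in M. (\<lambda>n. mixture_wealth robbins_mixture m X n \<omega>) \<longlonglongrightarrow> 0"
      by (rule tendsto[OF finite_measure_robbins_mixture(1) _ finite_measure_robbins_mixture(2,3)])
        (simp add: robbins_mixture_def)
  qed
qed

end
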